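(* Let $\{e^{tA}\}_{t\geq0}$ be a strongly continuous semigroup, with generator $A$, on a Hilbert space $\mathcal{H}$ with norm $\|\cdot\|$. Suppose that for some element $f\in\mathbf{D}(A^2)\setminus\{0\}$ the following family of orbital estimates holds: $$\|e^{tA}(A+\lambda)f\|\leq \|(A+\lambda)f\|\quad\text{for all } t\geq0 \text{ and all } \lambda>0.$$ Then, for the same $f$, $$\|Af\|^2\leq2\|f\|\,\|A^2f\|.$$
   Context: For a strongly continuous semigroup $\{e^{tA}\}_{t\geq 0}$ of bounded linear operators on a Hilbert space $\mathcal{H}$, $A$ denotes its (in general unbounded) infinitesimal generator with domain $\mathbf{D}(A)$, and $\mathbf{D}(A^2)=\{f\in\mathbf{D}(A): Af\in\mathbf{D}(A)\}$. Here $(A+\lambda)f=Af+\lambda f$. The semigroup is not assumed contractive. *)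

theory Defs
  imports "HOL-Analysis.Analysis"
begin

(*
  Hilbert spaces are rendered by the sort {real_inner, complete_space}. This also covers complex
  Hilbert spaces: with the real inner product Re <x, y> such a space is a real Hilbert space with
  the same norm, bounded complex-linear operators are bounded real-linear, and a strongly continuous
  semigroup keeps its generator, domain included.

  A semigroup is a family T indexed by real; only the operators T t with t >= 0 are constrained or
  used.
*)

definition strongly_continuous_semigroup ::
  "(real \<Rightarrow> 'a \<Rightarrow> 'a :: real_normed_vector) \<Rightarrow> bool" where
  "strongly_continuous_semigroup T \<longleftrightarrow>
     (\<forall>t\<ge>0. bounded_linear (T t)) \<and>
     (\<forall>x. T 0 x = x) \<and>
     (\<forall>s\<ge>0. \<forall>t\<ge>0. \<forall>x. T (s + t) x = T s (T t x)) \<and>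
     (\<forall>x. ((\<lambda>t. T t x) \<longlongrightarrow> x) (at_right 0))"

definition gen_domain :: "(real \<Rightarrow> 'a \<Rightarrow> 'a :: real_normed_vector) \<Rightarrow> 'a set" where
  "gen_domain T = {x. \<exists>y. ((\<lambda>t. (T t x - x) /\<^sub>R t) \<longlongrightarrow> y) (at_right 0)}"

(* Unspecified outside gen_domain T. *)
definition generator :: "(real \<Rightarrow> 'a \<Rightarrow> 'a :: real_normed_vector) \<Rightarrow> 'a \<Rightarrow> 'a" where
  "generator T x = Lim (at_right 0) (\<lambda>t. (T t x - x) /\<^sub>R t)"

definition gen_domain2 :: "(real \<Rightarrow> 'a \<Rightarrow> 'a :: real_normed_vector) \<Rightarrow> 'a set" where
  "gen_domain2 T = {x \<in> gen_domain T. generator T x \<in> gen_domain T}"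

end

theory Submission
  imports Defs
begin

text \<open>
  The estimate for the orbit of \<open>g = A f + \<mu> f\<close> says, to first order at \<open>t = 0\<close>, that
  \<open>\<langle>A g, g\<rangle> \<le> 0\<close> (lemma \<open>inner_generator_nonpos\<close>). Hence subtracting a positive multiple of \<open>g\<close> from \<open>A g\<close>
  cannot give a shorter vector than adding it. The multiple \<open>\<mu> g\<close> is chosen because the cross
  terms then cancel in the difference and add up in the sum:
  \[
    A g - \mu g = A^2 f - \mu^2 f, \qquad A g + \mu g = A^2 f + 2 \mu A f + \mu^2 f .
  \]
  So \<open>2 \<mu> A f\<close> is the difference of \<open>A g + \<mu> g\<close>, which is no longer than \<open>A\<^sup>2 f - \<mu>\<^sup>2 f\<close>, and
  \<open>A\<^sup>2 f + \<mu>\<^sup>2 f\<close>. The parallelogram law combines the two bounds into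
  \<open>\<mu>\<^sup>2 \<parallel>A f\<parallel>\<^sup>2 \<le> \<parallel>A\<^sup>2 f\<parallel>\<^sup>2 + \<mu>\<^sup>4 \<parallel>f\<parallel>\<^sup>2\<close> (lemma \<open>landau_inequality_with_parameter\<close>), and the best
  choice \<open>\<mu>\<^sup>2 = \<parallel>A\<^sup>2 f\<parallel> / \<parallel>f\<parallel>\<close> (or \<open>\<mu> \<rightarrow> 0\<close> if \<open>A\<^sup>2 f = 0\<close>)
  yields the constant 2.
\<close>

lemma generator_tendsto:
  assumes "x \<in> gen_domain T"
  shows "((\<lambda>t. (T t x - x) /\<^sub>R t) \<longlongrightarrow> generator T x) (at_right 0)"
proof -
  obtain y where y: "((\<lambda>t. (T t x - x) /\<^sub>R t) \<longlongrightarrow> y) (at_right 0)"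
    using assms unfolding gen_domain_def by blast
  moreover from y have "generator T x = y"
    unfolding generator_def by (intro tendsto_Lim) auto
  ultimately show ?thesis by simp
qed

lemma generator_tendsto_add_scaleR:
  assumes lin: "\<And>t. t \<ge> 0 \<Longrightarrow> linear (T t)"
    and x: "x \<in> gen_domain T" and y: "y \<in> gen_domain T"
  shows "((\<lambda>t. (T t (x + c *\<^sub>R y) - (x + c *\<^sub>R y)) /\<^sub>R t)
            \<longlongrightarrow> generator T x + c *\<^sub>R generator T y) (at_right 0)"
proof (rule Lim_transform_eventually)
  show "((\<lambda>t. (T t x - x) /\<^sub>R t + c *\<^sub>R ((T t y - y) /\<^sub>R t))
          \<longlongrightarrow> generator T x + c *\<^sub>R generator T y) (at_right 0)"
    by (intro tendsto_intros generator_tendsto x y)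
  have "(T t x - x) /\<^sub>R t + c *\<^sub>R ((T t y - y) /\<^sub>R t)
          = (T t (x + c *\<^sub>R y) - (x + c *\<^sub>R y)) /\<^sub>R t" if "t > 0" for t
    using lin[of t] that by (simp add: linear_add linear_scale algebra_simps)
  then show "\<forall>\<^sub>F t in at_right 0. (T t x - x) /\<^sub>R t + c *\<^sub>R ((T t y - y) /\<^sub>R t)
          = (T t (x + c *\<^sub>R y) - (x + c *\<^sub>R y)) /\<^sub>R t"
    by (auto simp: eventually_at_filter)
qed

text \<open>
  By Cauchy--Schwarz, \<open>\<langle>u t, g\<rangle> \<le> \<parallel>g\<parallel>\<^sup>2\<close> for every point \<open>u t\<close> of a curve that starts at \<open>g\<close> and
  stays within the ball of radius \<open>\<parallel>g\<parallel>\<close> around 0, so every difference quotient at \<open>g\<close> already has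
  nonpositive inner product with \<open>g\<close>, and the limit inherits the sign.
\<close>

lemma inner_generator_nonpos:
  fixes u :: "real \<Rightarrow> 'a :: real_inner"
  assumes lim: "((\<lambda>t. (u t - g) /\<^sub>R t) \<longlongrightarrow> h) (at_right 0)"
    and bound: "\<And>t. t \<ge> 0 \<Longrightarrow> norm (u t) \<le> norm g"
  shows "inner h g \<le> 0"
proof (rule tendsto_upperbound)
  show "((\<lambda>t. inner ((u t - g) /\<^sub>R t) g) \<longlongrightarrow> inner h g) (at_right 0)"
    by (intro tendsto_intros lim)
  have "inner ((u t - g) /\<^sub>R t) g \<le> 0" if "t > 0" for t
  proof -
    have "inner (u t) g \<le> norm (u t) * norm g"
      by (rule norm_cauchy_schwarz)
    also have "\<dots> \<le> norm g * norm g"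
      using bound[of t] that by (intro mult_right_mono) auto
    also have "\<dots> = inner g g"
      by (simp flip: power2_eq_square add: power2_norm_eq_inner)
    finally have "inner (u t - g) g \<le> 0"
      by (simp add: inner_diff_left)
    then show ?thesis
      using that by (simp add: mult_nonneg_nonpos)
  qed
  then show "\<forall>\<^sub>F t in at_right 0. inner ((u t - g) /\<^sub>R t) g \<le> 0"
    by (auto simp: eventually_at_filter)
qed simp

text \<open>
  In the application \<open>x = A\<^sup>2 f\<close>, \<open>y = A f\<close> and \<open>z = f\<close>. The hypothesis
  makes \<open>x + 2 \<mu> y + \<mu>\<^sup>2 z\<close> no longer than \<open>x - \<mu>\<^sup>2 z\<close>, since the difference of the squared norms
  is \<open>4 \<mu>\<close> times the given inner product.
\<close>

lemma landau_inequality_with_parameter: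
  fixes x y z :: "'a :: real_inner"
  assumes "\<mu> > 0" and "inner (x + \<mu> *\<^sub>R y) (y + \<mu> *\<^sub>R z) \<le> 0"
  shows "\<mu>\<^sup>2 * (norm y)\<^sup>2 \<le> (norm x)\<^sup>2 + (\<mu>\<^sup>2)\<^sup>2 * (norm z)\<^sup>2"
proof -
  define w where "w = \<mu>\<^sup>2 *\<^sub>R z"
  define v where "v = (2 * \<mu>) *\<^sub>R y"
  have parallelogram: "(norm (a + b))\<^sup>2 + (norm (a - b))\<^sup>2 = 2 * (norm a)\<^sup>2 + 2 * (norm b)\<^sup>2"
    for a b :: 'a
    by (simp add: power2_norm_eq_inner inner_add inner_diff inner_commute)
  have "(norm (x + w + v))\<^sup>2 - (norm (x - w))\<^sup>2
      = 4 * \<mu> * inner (x + \<mu> *\<^sub>R y) (y + \<mu> *\<^sub>R z)"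
    unfolding v_def w_def power2_norm_eq_inner
    by (simp add: inner_add inner_diff inner_commute algebra_simps power2_eq_square)
  also have "\<dots> \<le> 0"
    using assms by (simp add: mult_nonneg_nonpos)
  finally have dissipative: "(norm (x + w + v))\<^sup>2 \<le> (norm (x - w))\<^sup>2"
    by simp
  have "(norm v)\<^sup>2 = (norm ((x + w + v) - (x + w)))\<^sup>2"
    by simp
  also have "\<dots> \<le> 2 * (norm (x + w + v))\<^sup>2 + 2 * (norm (x + w))\<^sup>2"
    using parallelogram[of "x + w + v" "x + w"]
      zero_le_power2[of "norm ((x + w + v) + (x + w))"] by linarith
  also have "\<dots> \<le> 4 * (norm x)\<^sup>2 + 4 * (norm w)\<^sup>2"
    using dissipative parallelogram[of x w] by linarith
  finally show ?thesis
    by (simp add: v_def w_def power_mult_distrib)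
qed

lemma le_two_mult_of_quadratic_bounds:
  fixes a b p :: real
  assumes "a \<ge> 0" and "b > 0"
    and bound: "\<And>s. s > 0 \<Longrightarrow> s * p \<le> a\<^sup>2 + s\<^sup>2 * b\<^sup>2"
  shows "p \<le> 2 * a * b"
proof (cases "a = 0")
  case False
  then have "a / b > 0"
    using assms by simp
  from bound[OF this] have "(a / b) * p \<le> (a / b) * (2 * a * b)"
    using \<open>b > 0\<close> by (simp add: power2_eq_square)
  then show ?thesis
    using \<open>a / b > 0\<close> by (simp only: mult_le_cancel_left_pos)
next
  case True
  \<comment> \<open>The minimiser \<open>a / b\<close> degenerates to 0; any \<open>s\<close> below \<open>p / b\<^sup>2\<close> refutes \<open>p > 0\<close>.\<close>
  show ?thesis
  proof (rule ccontr)
    assume "\<not> p \<le> 2 * a * b"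
    then have "p > 0"
      using True by simp
    define s where "s = p / (2 * b\<^sup>2)"
    have "s > 0"
      using \<open>p > 0\<close> \<open>b > 0\<close> by (simp add: s_def)
    have "s * p \<le> s * (s * b\<^sup>2)"
      using bound[OF \<open>s > 0\<close>] True by (simp add: power2_eq_square mult.assoc)
    then have "p \<le> s * b\<^sup>2"
      using \<open>s > 0\<close> by (simp only: mult_le_cancel_left_pos)
    also have "s * b\<^sup>2 = p / 2"
      using \<open>b > 0\<close> by (simp add: s_def)
    finally show False
      using \<open>p > 0\<close> by simp
  qed
qed

theorem theorem4p2:
  fixes T :: "real \<Rightarrow> 'a \<Rightarrow> 'a :: {real_inner, complete_space}"
    and A :: "'a \<Rightarrow> 'a"
    and f :: 'a
  assumes "strongly_continuous_semigroup T"
    and "A = generator T"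
    and "f \<in> gen_domain2 T - {0}"
    and "\<And>t \<mu>. t \<ge> 0 \<Longrightarrow> \<mu> > 0 \<Longrightarrow> norm (T t (A f + \<mu> *\<^sub>R f)) \<le> norm (A f + \<mu> *\<^sub>R f)"
  shows "(norm (A f))\<^sup>2 \<le> 2 * norm f * norm (A (A f))"
proof -
  have lin: "linear (T t)" if "t \<ge> 0" for t
    using assms(1) that unfolding strongly_continuous_semigroup_def
    by (blast intro: bounded_linear.linear)
  have dom: "f \<in> gen_domain T" "A f \<in> gen_domain T" and "f \<noteq> 0"
    using assms(2,3) by (auto simp: gen_domain2_def)
  have "inner (A (A f) + \<mu> *\<^sub>R A f) (A f + \<mu> *\<^sub>R f) \<le> 0" if "\<mu> > 0" for \<mu>
  proof (rule inner_generator_nonpos)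
    show "((\<lambda>t. (T t (A f + \<mu> *\<^sub>R f) - (A f + \<mu> *\<^sub>R f)) /\<^sub>R t)
            \<longlongrightarrow> A (A f) + \<mu> *\<^sub>R A f) (at_right 0)"
      using generator_tendsto_add_scaleR[OF lin dom(2,1)] by (simp add: assms(2))
  qed (use assms(4) that in auto)
  then have param: "\<mu>\<^sup>2 * (norm (A f))\<^sup>2 \<le> (norm (A (A f)))\<^sup>2 + (\<mu>\<^sup>2)\<^sup>2 * (norm f)\<^sup>2"
    if "\<mu> > 0" for \<mu>
    using that by (intro landau_inequality_with_parameter) auto
  have "(norm (A f))\<^sup>2 \<le> 2 * norm (A (A f)) * norm f"
  proof (rule le_two_mult_of_quadratic_bounds)
    show "s * (norm (A f))\<^sup>2 \<le> (norm (A (A f)))\<^sup>2 + s\<^sup>2 * (norm f)\<^sup>2" if "s > 0" for s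
      using param[of "sqrt s"] that by simp
  qed (use \<open>f \<noteq> 0\<close> in auto)
  then show ?thesis
    by (simp add: mult_ac)
qed

end
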